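(* Consider the system $\dot x=f(x)+g(x)u$ with cost $J(x_0,u)=\int_0^\infty r(x(t),u(t))\,dt$, $x(0)=x_0$, as in the context. Assume: (A1) there exist $V_0\in\mathcal{P}$ and a feedback control policy $u_1$ such that $\mathcal{L}(V_0(x),u_1(x))\ge 0$ for all $x\in\mathbb{R}^n$; (A2) there exists $V^{\rm o}\in\mathcal{P}$ such that $\mathcal{H}(V^{\rm o})=0$ on $\mathbb{R}^n$; let $u^{\rm o}(x)=-\frac12R^{-1}(x)g^T(x)\nabla V^{\rm o}(x)$. Let $\Omega\subset\mathbb{R}^n$ be an arbitrary compact set containing the origin as an interior point, and consider the optimization problem (RP): $$\min_V\int_\Omega V(x)\,dx\quad\text{subject to}\quad \mathcal{H}(V)\le 0\ \text{ on }\mathbb{R}^n,\quad V\in\mathcal{P}.$$ Then: 1) Problem (RP) has a nonempty feasible set. 2) If $V$ is a feasible solution to (RP), then the control policy $\bar u(x)=-\frac12R^{-1}(x)g^T(x)\nabla V(x)$ is globally stabilizing. 3) If $V$ is a feasible solution to (RP) and $\bar u$ is as in 2), then for any $x_0\in\mathbb{R}^n$ the cost of the closed-loop system with $u=\bar u$ satisfies $J(x_0,\bar u)\le V(x_0)$. 4) If $V$ is a feasible solution to (RP), then for any $x_0\in\mathbb{R}^n$, along the trajectory $x(t)$ of the closed-loop system $\dot x=f(x)+g(x)u^{\rm o}(x)$, $x(0)=x_0$, $$V(x_0)+\int_0^\infty\mathcal{H}(V(x(t)))\,dt\le V^{\rm o}(x_0)\le V(x_0).$$ 5) $V^{\rm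 o}$ is a global optimal solution to (RP).
   Context: Here $x\in\mathbb{R}^n$ is the state, $u\in\mathbb{R}^m$ the control, and $f:\mathbb{R}^n\to\mathbb{R}^n$, $g:\mathbb{R}^n\to\mathbb{R}^{n\times m}$ are polynomial mappings with $f(0)=0$. The running cost is $r(x,u)=q(x)+u^TR(x)u$, with $q$ a positive definite polynomial function and $R(x)$ a symmetric positive definite matrix of polynomials. $\mathcal{C}^1$ is the set of continuously differentiable functions; $\mathcal{P}$ is the set of functions in $\mathcal{C}^1$ on $\mathbb{R}^n$ that are also positive definite (zero at the origin, positive elsewhere) and proper (radially unbounded). $\nabla V$ is the gradient (a column vector). For $V\in\mathcal{C}^1$ and a control $u$, $$\mathcal{L}(V,u)=-\nabla V^T(x)\big(f(x)+g(x)u\big)-r(x,u),$$ $$\mathcal{H}(V)=\nabla V^T(x)f(x)+q(x)-\tfrac14\nabla V^T(x)g(x)R^{-1}(x)g^T(x)\nabla V(x).$$ Both are functions of $x$; $\mathcal{H}(V(x(t)))$ denotes the value of $\mathcal{H}(V)$ at $x(t)$. A feedback control policy $u$ is called globally stabilizing if the closed-loop system under it is globally asymptotically stable at the origin. Under (A2), $V^{\rm o}$ is the optimal cost: $V^{\rm o}(x_0)=\min_uJ(x_0,u)=J(x_0,u^{\rm o})$ for all $x_0\in\mathbb{R}^n$. *)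

theory Defs
  imports "HOL-Analysis.Analysis"
begin

definition gradient :: "(real ^ 'n \<Rightarrow> real) \<Rightarrow> real ^ 'n \<Rightarrow> real ^ 'n" where
  "gradient V x = (\<chi> i. frechet_derivative V (at x) (axis i 1))"

definition C1 :: "(real ^ 'n \<Rightarrow> real) set" where
  "C1 = {V. (\<forall>x. V differentiable (at x)) \<and> continuous_on UNIV (gradient V)}"

definition pos_def_fun :: "(real ^ 'n \<Rightarrow> real) \<Rightarrow> bool" where
  "pos_def_fun V \<longleftrightarrow> V 0 = 0 \<and> (\<forall>x. x \<noteq> 0 \<longrightarrow> V x > 0)"

definition proper_fun :: "(real ^ 'n \<Rightarrow> real) \<Rightarrow> bool" where
  "proper_fun V \<longleftrightarrow> filterlim V at_top at_infinity"

definition class_P :: "(real ^ 'n \<Rightarrow> real) set" where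
  "class_P = {V \<in> C1. pos_def_fun V \<and> proper_fun V}"

definition sym_pos_def :: "real ^ 'm ^ 'm \<Rightarrow> bool" where
  "sym_pos_def A \<longleftrightarrow> transpose A = A \<and> (\<forall>u. u \<noteq> 0 \<longrightarrow> u \<bullet> (A *v u) > 0)"

definition running_cost ::
  "(real ^ 'n \<Rightarrow> real) \<Rightarrow> (real ^ 'n \<Rightarrow> real ^ 'm ^ 'm) \<Rightarrow> real ^ 'n \<Rightarrow> real ^ 'm \<Rightarrow> real" where
  "running_cost q R x u = q x + u \<bullet> (R x *v u)"

definition op_L ::
  "(real ^ 'n \<Rightarrow> real ^ 'n) \<Rightarrow> (real ^ 'n \<Rightarrow> real ^ 'm ^ 'n) \<Rightarrow> (real ^ 'n \<Rightarrow> real) \<Rightarrow>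
   (real ^ 'n \<Rightarrow> real ^ 'm ^ 'm) \<Rightarrow> (real ^ 'n \<Rightarrow> real) \<Rightarrow> (real ^ 'n \<Rightarrow> real ^ 'm) \<Rightarrow>
   real ^ 'n \<Rightarrow> real" where
  "op_L f g q R V u x =
     - (gradient V x \<bullet> (f x + g x *v u x)) - running_cost q R x (u x)"

definition op_H ::
  "(real ^ 'n \<Rightarrow> real ^ 'n) \<Rightarrow> (real ^ 'n \<Rightarrow> real ^ 'm ^ 'n) \<Rightarrow> (real ^ 'n \<Rightarrow> real) \<Rightarrow>
   (real ^ 'n \<Rightarrow> real ^ 'm ^ 'm) \<Rightarrow> (real ^ 'n \<Rightarrow> real) \<Rightarrow> real ^ 'n \<Rightarrow> real" where
  "op_H f g q R V x =
     gradient V x \<bullet> f x + q x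
     - 1 / 4 * (gradient V x \<bullet>
         (g x *v (matrix_inv (R x) *v (transpose (g x) *v gradient V x))))"

definition policy ::
  "(real ^ 'n \<Rightarrow> real ^ 'm ^ 'n) \<Rightarrow> (real ^ 'n \<Rightarrow> real ^ 'm ^ 'm) \<Rightarrow> (real ^ 'n \<Rightarrow> real) \<Rightarrow>
   real ^ 'n \<Rightarrow> real ^ 'm" where
  "policy g R V x =
     - (1 / 2) *\<^sub>R (matrix_inv (R x) *v (transpose (g x) *v gradient V x))"

definition closed_loop ::
  "(real ^ 'n \<Rightarrow> real ^ 'n) \<Rightarrow> (real ^ 'n \<Rightarrow> real ^ 'm ^ 'n) \<Rightarrow> (real ^ 'n \<Rightarrow> real ^ 'm) \<Rightarrow>
   real ^ 'n \<Rightarrow> real ^ 'n" where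
  "closed_loop f g u x = f x + g x *v u x"

definition solution_on ::
  "(real ^ 'n \<Rightarrow> real ^ 'n) \<Rightarrow> real set \<Rightarrow> (real \<Rightarrow> real ^ 'n) \<Rightarrow> bool" where
  "solution_on F I x \<longleftrightarrow> (\<forall>t\<in>I. (x has_vector_derivative F (x t)) (at t within I))"

definition trajectory ::
  "(real ^ 'n \<Rightarrow> real ^ 'n) \<Rightarrow> real ^ 'n \<Rightarrow> (real \<Rightarrow> real ^ 'n) \<Rightarrow> bool" where
  "trajectory F x0 x \<longleftrightarrow> solution_on F {0..} x \<and> x 0 = x0"

text \<open>
  For V merely continuously differentiable, the closed-loop vector field is only continuous, so
  trajectories need not be unique. Global asymptotic stability therefore requires that
  trajectories exist from every initial state, that no solution escapes in finite time,
  and that stability and attractivity hold for all trajectories.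
\<close>

definition forward_complete :: "(real ^ 'n \<Rightarrow> real ^ 'n) \<Rightarrow> bool" where
  "forward_complete F \<longleftrightarrow>
     (\<forall>x0. \<exists>x. trajectory F x0 x) \<and>
     (\<forall>T>0. \<forall>y. solution_on F {0..<T} y \<longrightarrow>
        (\<exists>x. solution_on F {0..} x \<and> (\<forall>t\<in>{0..<T}. x t = y t)))"

definition GAS_at_origin :: "(real ^ 'n \<Rightarrow> real ^ 'n) \<Rightarrow> bool" where
  "GAS_at_origin F \<longleftrightarrow>
     F 0 = 0 \<and> forward_complete F \<and>
     (\<forall>\<epsilon>>0. \<exists>\<delta>>0. \<forall>x0 x. norm x0 < \<delta> \<longrightarrow> trajectory F x0 x \<longrightarrow>
        (\<forall>t\<ge>0. norm (x t) < \<epsilon>)) \<and>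
     (\<forall>x0 x. trajectory F x0 x \<longrightarrow> (x \<longlongrightarrow> 0) at_top)"

definition globally_stabilizing ::
  "(real ^ 'n \<Rightarrow> real ^ 'n) \<Rightarrow> (real ^ 'n \<Rightarrow> real ^ 'm ^ 'n) \<Rightarrow> (real ^ 'n \<Rightarrow> real ^ 'm) \<Rightarrow> bool"
  where
  "globally_stabilizing f g u \<longleftrightarrow> GAS_at_origin (closed_loop f g u)"

text \<open>
  The integral over the half-line is extended-real-valued: the one of a nonpositive integrand may
  be minus infinity, where the Bochner or gauge integral would return the default value 0.
  The coercion to ennreal truncates negative values to 0, so this is the difference
  of the integrals of the positive and the negative part.
\<close>

definition integral_0_inf :: "(real \<Rightarrow> real) \<Rightarrow> ereal" where
  "integral_0_inf h =
     enn2ereal (\<integral>\<^sup>+t\<in>{0..}. ennreal (h t) \<partial>lborel)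
     - enn2ereal (\<integral>\<^sup>+t\<in>{0..}. ennreal (- h t) \<partial>lborel)"

definition cost_J ::
  "(real ^ 'n \<Rightarrow> real) \<Rightarrow> (real ^ 'n \<Rightarrow> real ^ 'm ^ 'm) \<Rightarrow> (real \<Rightarrow> real ^ 'n) \<Rightarrow>
   (real \<Rightarrow> real ^ 'm) \<Rightarrow> ereal" where
  "cost_J q R x u = integral_0_inf (\<lambda>t. running_cost q R (x t) (u t))"

definition RP_feasible ::
  "(real ^ 'n \<Rightarrow> real ^ 'n) \<Rightarrow> (real ^ 'n \<Rightarrow> real ^ 'm ^ 'n) \<Rightarrow> (real ^ 'n \<Rightarrow> real) \<Rightarrow>
   (real ^ 'n \<Rightarrow> real ^ 'm ^ 'm) \<Rightarrow> (real ^ 'n \<Rightarrow> real) set" where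
  "RP_feasible f g q R = {V \<in> class_P. \<forall>x. op_H f g q R V x \<le> 0}"

definition RP_optimal ::
  "(real ^ 'n \<Rightarrow> real ^ 'n) \<Rightarrow> (real ^ 'n \<Rightarrow> real ^ 'm ^ 'n) \<Rightarrow> (real ^ 'n \<Rightarrow> real) \<Rightarrow>
   (real ^ 'n \<Rightarrow> real ^ 'm ^ 'm) \<Rightarrow> (real ^ 'n) set \<Rightarrow> (real ^ 'n \<Rightarrow> real) \<Rightarrow> bool" where
  "RP_optimal f g q R \<Omega> V \<longleftrightarrow>
     V \<in> RP_feasible f g q R \<and>
     (\<forall>W\<in>RP_feasible f g q R. integral \<Omega> V \<le> integral \<Omega> W)"

end

theory Submission
  imports Defs "HOL-Complex_Analysis.Great_Picard"
begin

text \<open>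
  Completing the square in the control shows that, along the closed loop with any feedback \<open>w\<close>,
  the derivative of \<open>V\<close> equals \<open>\<H>(V) - r(x, w) + |w - u\<^sub>V|\<^sup>2\<close>, where \<open>u\<^sub>V\<close> is the policy of \<open>V\<close>
  and the square is taken in the norm of \<open>R(x)\<close>. For \<open>w = u\<^sub>V\<close> and \<open>V\<close> feasible this makes
  \<open>V\<close> a strict Lyapunov function that decreases at least at the rate of the running cost, which
  gives stability and the cost bound. Comparing \<open>V\<close> with \<open>V\<^sub>o\<close> along the closed loop of \<open>u\<^sub>o\<close> gives the
  lower estimate for \<open>V\<^sub>o\<close>, and along the closed loop of \<open>u\<^sub>V\<close> it gives \<open>V\<^sub>o \<le> V\<close>. The closed-loop
  vector field is only continuous, so trajectories come from Peano's theorem applied to a bounded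
  truncation of the field, which the Lyapunov function shows to be inactive.
\<close>

section \<open>Peano existence\<close>

lemma norm_integral_diff_le:
  fixes \<phi> :: "real \<Rightarrow> 'a::euclidean_space"
  assumes \<phi>: "continuous_on {0..b} \<phi>" and M: "\<And>t. t \<in> {a..b} \<Longrightarrow> norm (\<phi> t) \<le> M"
    and "0 \<le> a" "a \<le> b"
  shows "norm (integral {0..b} \<phi> - integral {0..a} \<phi>) \<le> M * (b - a)"
proof -
  have "integral {0..a} \<phi> + integral {a..b} \<phi> = integral {0..b} \<phi>"
    using assms by (intro Henstock_Kurzweil_Integration.integral_combine integrable_continuous_real) auto
  moreover have "norm (integral {a..b} \<phi>) \<le> M * (b - a)"
    using assms by (intro integral_bound) (auto intro: continuous_on_subset)
  ultimately show ?thesis by (metis add_diff_cancel_left')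
qed

text \<open>The integral form survives uniform limits and continuous extension to an endpoint, where
  derivatives are not directly controlled. This lemma turns it back into a solution, in Peano's
  theorem and in the extension to a closed interval.\<close>

lemma solution_on_of_integral_equation:
  assumes F: "continuous_on UNIV F" and x: "continuous_on {0..T} x"
    and eq: "\<And>t. t \<in> {0..T} \<Longrightarrow> x t = x0 + integral {0..t} (\<lambda>s. F (x s))"
  shows "solution_on F {0..T} x"
  unfolding solution_on_def
proof
  fix t assume t: "t \<in> {0..T}"
  have "continuous_on {0..T} (\<lambda>s. F (x s))"
    by (rule continuous_on_compose2[OF F x]) auto
  from has_vector_derivative_add[OF has_vector_derivative_const integral_has_vector_derivative[OF this t], of x0]
  have "((\<lambda>t. x0 + integral {0..t} (\<lambda>s. F (x s))) has_vector_derivative F (x t)) (at t within {0..T})"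
    by simp
  then show "(x has_vector_derivative F (x t)) (at t within {0..T})"
    by (rule has_vector_derivative_transform[rotated 2]) (use t eq in auto)
qed

text \<open>Tonelli's scheme: delaying the right-hand side by \<open>h\<close> makes the integral equation explicitly
  solvable, because the \<open>k\<close>-th Picard iterate is already exact up to time \<open>k h\<close>.\<close>

lemma delayed_integral_equation_solution:
  fixes G :: "'a::euclidean_space \<Rightarrow> 'a"
  assumes G: "continuous_on UNIV G" and M: "\<And>x. norm (G x) \<le> M" and h: "0 < h"
  obtains y where "M-lipschitz_on UNIV y"
    "\<And>t. t \<le> real n * h \<Longrightarrow> y t = x0 + integral {0..max (t - h) 0} (\<lambda>s. G (y s))"
proof -
  \<comment> \<open>Clamping the upper limit at 0 makes every iterate constant for
    \<open>t \<le> h\<close>, negative times included, so the Lipschitz bound can be proved on the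
    whole line.\<close>
  define Y where "Y = rec_nat (\<lambda>t. x0) (\<lambda>k y t. x0 + integral {0..max (t - h) 0} (\<lambda>s. G (y s)))"
  have Y0: "Y 0 = (\<lambda>t. x0)" by (simp add: Y_def)
  have YS: "Y (Suc k) = (\<lambda>t. x0 + integral {0..max (t - h) 0} (\<lambda>s. G (Y k s)))" for k
    by (simp add: Y_def)
  have M0: "0 \<le> M" using M[of 0] norm_ge_zero order_trans by blast
  \<comment> \<open>The constant depends neither on \<open>k\<close> nor on \<open>h\<close>,
    because clamping the delayed time is nonexpansive; this becomes the equicontinuity needed for
    Arzela-Ascoli.\<close>
  have lip: "M-lipschitz_on UNIV (Y k)" for k
  proof (induction k)
    case 0
    then show ?case unfolding Y0 using M0 by (auto intro!: lipschitz_onI)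
  next
    case (Suc k)
    have c: "continuous_on UNIV (\<lambda>s. G (Y k s))"
      by (rule continuous_on_compose2[OF G lipschitz_on_continuous_on[OF Suc]]) auto
    have *: "dist (Y (Suc k) a) (Y (Suc k) b) \<le> M * dist a b" if "a \<le> b" for a b
    proof -
      have "dist (Y (Suc k) a) (Y (Suc k) b)
          = norm (integral {0..max (b - h) 0} (\<lambda>s. G (Y k s)) - integral {0..max (a - h) 0} (\<lambda>s. G (Y k s)))"
        by (simp add: YS dist_norm norm_minus_commute)
      also have "\<dots> \<le> M * (max (b - h) 0 - max (a - h) 0)"
        using that by (intro norm_integral_diff_le continuous_on_subset[OF c] M) auto
      also have "\<dots> \<le> M * dist a b"
        using that M0 by (intro mult_left_mono) (auto simp: dist_real_def)
      finally show ?thesis .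
    qed
    show ?case
    proof (rule lipschitz_onI)
      fix a b :: real
      show "dist (Y (Suc k) a) (Y (Suc k) b) \<le> M * dist a b"
        using *[of a b] *[of b a] by (cases "a \<le> b") (auto simp: dist_commute)
    qed (rule M0)
  qed
  \<comment> \<open>Up to time \<open>(k + 1) h\<close> the right-hand side reads the previous
    iterate only up to time \<open>k h\<close>, where the induction hypothesis applies.\<close>
  have stab: "Y (Suc k) t = Y k t" if "t \<le> real k * h" for k t
    using that
  proof (induction k arbitrary: t)
    case 0
    then show ?case using h by (simp add: YS Y0 max_def)
  next
    case (Suc k)
    have "integral {0..max (t - h) 0} (\<lambda>s. G (Y (Suc k) s)) = integral {0..max (t - h) 0} (\<lambda>s. G (Y k s))"
    proof (rule Henstock_Kurzweil_Integration.integral_cong)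
      fix s assume "s \<in> {0..max (t - h) 0}"
      then have "s \<le> max (t - h) 0" by simp
      also have "\<dots> \<le> real k * h" using Suc.prems h by (simp add: algebra_simps)
      finally show "G (Y (Suc k) s) = G (Y k s)" using Suc.IH by simp
    qed
    then show ?case by (simp add: YS[of "Suc k"]) (simp add: YS[of k])
  qed
  show ?thesis
  proof
    show "M-lipschitz_on UNIV (Y n)" by (rule lip)
    show "Y n t = x0 + integral {0..max (t - h) 0} (\<lambda>s. G (Y n s))" if "t \<le> real n * h" for t
      using stab[OF that] by (simp add: YS)
  qed
qed

text \<open>Solutions with delay \<open>1 / (n + 1)\<close> are uniformly bounded and
  equi-Lipschitz, so a subsequence converges uniformly. Dominated convergence passes to the limit in
  the integral, and the error caused by the delay vanishes.\<close>

lemma peano_existence_unit_interval: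
  fixes G :: "real ^ 'n \<Rightarrow> real ^ 'n"
  assumes G: "continuous_on UNIV G" and M: "\<And>x. norm (G x) \<le> M"
  obtains x where "solution_on G {0..1} x" "x 0 = x0"
proof -
  have M0: "0 \<le> M" using M[of 0] norm_ge_zero order_trans by blast
  \<comment> \<open>Taking \<open>n + 1\<close> steps of length \<open>1 / (n + 1)\<close> covers
    times up to exactly 1.\<close>
  have "\<exists>y. M-lipschitz_on UNIV y \<and>
      (\<forall>t\<le>1. y t = x0 + integral {0..max (t - 1 / real (Suc n)) 0} (\<lambda>s. G (y s)))" for n
    using delayed_integral_equation_solution[OF G M, of "1 / real (Suc n)" "Suc n" x0] by auto
  then obtain y where lip: "\<And>n. M-lipschitz_on UNIV (y n)"
    and y: "\<And>n t. t \<le> 1 \<Longrightarrow> y n t = x0 + integral {0..max (t - 1 / real (Suc n)) 0} (\<lambda>s. G (y n s))"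
    by metis
  have cy: "continuous_on A (\<lambda>s. G (y n s))" for n A
    by (rule continuous_on_compose2[OF G continuous_on_subset[OF lipschitz_on_continuous_on[OF lip]]]) auto
  have y0: "y n 0 = x0" for n using y[of 0 n] by (simp add: max_def)
  obtain z k where z: "continuous_on {0..1} z" and k: "strict_mono (k :: nat \<Rightarrow> nat)"
    and lim: "\<And>e. 0 < e \<Longrightarrow> \<exists>N. \<forall>n x. n \<ge> N \<and> x \<in> {0..1} \<longrightarrow> norm (y (k n) x - z x) < e"
  proof (rule Arzela_Ascoli[of "{0..1::real}" y "norm x0 + M"])
    fix n and t :: real assume t: "t \<in> {0..1}"
    have "norm (y n t) \<le> norm (y n 0) + dist (y n t) (y n 0)"
      by (metis dist_norm norm_triangle_sub)
    also have "dist (y n t) (y n 0) \<le> M * dist t 0"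
      by (rule lipschitz_onD[OF lip]) auto
    also have "M * dist t 0 \<le> M" using t M0 by (simp add: mult_left_le)
    finally show "norm (y n t) \<le> norm x0 + M" by (simp add: y0)
  next
    fix t e :: real assume "0 < e"
    \<comment> \<open>Dividing by \<open>M + 1\<close> instead of \<open>M\<close> covers the case
      \<open>M = 0\<close>.\<close>
    show "\<exists>d>0. \<forall>n s. s \<in> {0..1} \<and> norm (t - s) < d \<longrightarrow> norm (y n t - y n s) < e"
    proof (intro exI[of _ "e / (M + 1)"] conjI allI impI)
      show "0 < e / (M + 1)" using \<open>0 < e\<close> M0 by simp
      fix n s assume s: "s \<in> {0..1} \<and> norm (t - s) < e / (M + 1)"
      have "norm (y n t - y n s) \<le> M * norm (t - s)"
        using lipschitz_onD[OF lip[of n], of t s] by (simp add: dist_norm)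
      also have "\<dots> \<le> (M + 1) * norm (t - s)" by (intro mult_right_mono) auto
      also have "\<dots> < e" using s M0 by (simp add: field_simps)
      finally show "norm (y n t - y n s) < e" .
    qed
  qed auto
  have ptw: "(\<lambda>n. y (k n) t) \<longlonglongrightarrow> z t" if "t \<in> {0..1}" for t
    unfolding LIMSEQ_iff using lim that by blast
  have eq: "z t = x0 + integral {0..t} (\<lambda>s. G (z s))" if t: "t \<in> {0..1}" for t
  proof -
    have int: "(\<lambda>n. integral {0..t} (\<lambda>s. G (y (k n) s))) \<longlonglongrightarrow> integral {0..t} (\<lambda>s. G (z s))"
    proof (rule dominated_convergence(2)[where h = "\<lambda>_. M"])
      show "(\<lambda>s. G (y (k n) s)) integrable_on {0..t}" for n
        by (intro integrable_continuous_real cy)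
      show "(\<lambda>n. G (y (k n) s)) \<longlonglongrightarrow> G (z s)" if "s \<in> {0..t}" for s
        using ptw[of s] that t G
        by (intro isCont_tendsto_compose[of _ G]) (auto simp: continuous_on_eq_continuous_at)
    qed (auto simp: M)
    \<comment> \<open>The defect in the undelayed equation is an integral over an interval no longer
      than the delay, hence at most \<open>M / (n + 1)\<close>. Its limit is also the defect of
      \<open>z\<close>, which must then be 0.\<close>
    have "(\<lambda>n. y (k n) t - (x0 + integral {0..t} (\<lambda>s. G (y (k n) s)))) \<longlonglongrightarrow> 0"
    proof (rule Lim_null_comparison)
      have "norm (y j t - (x0 + integral {0..t} (\<lambda>s. G (y j s)))) \<le> M * inverse (real (Suc j))" for j
      proof -
        have "norm (integral {0..t} (\<lambda>s. G (y j s)) - integral {0..max (t - 1 / real (Suc j)) 0} (\<lambda>s. G (y j s)))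
            \<le> M * (t - max (t - 1 / real (Suc j)) 0)"
          using t by (intro norm_integral_diff_le cy M) auto
        also have "\<dots> \<le> M * inverse (real (Suc j))"
          using M0 by (intro mult_left_mono) (auto simp: inverse_eq_divide)
        finally show ?thesis using y[of t j] t by (simp add: norm_minus_commute)
      qed
      then show "\<forall>\<^sub>F n in sequentially. norm (y (k n) t - (x0 + integral {0..t} (\<lambda>s. G (y (k n) s))))
          \<le> M * inverse (real (Suc (k n)))" by simp
      have "((\<lambda>j. M * inverse (real (Suc j))) \<circ> k) \<longlonglongrightarrow> M * 0"
        by (intro LIMSEQ_subseq_LIMSEQ[OF _ k] tendsto_mult tendsto_const LIMSEQ_inverse_real_of_nat)
      then show "(\<lambda>n. M * inverse (real (Suc (k n)))) \<longlonglongrightarrow> 0" by (simp add: o_def)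
    qed
    moreover have "(\<lambda>n. y (k n) t - (x0 + integral {0..t} (\<lambda>s. G (y (k n) s))))
        \<longlonglongrightarrow> z t - (x0 + integral {0..t} (\<lambda>s. G (z s)))"
      by (intro tendsto_intros ptw t int)
    ultimately show ?thesis using LIMSEQ_unique by fastforce
  qed
  show ?thesis
  proof
    show "solution_on G {0..1} z" by (rule solution_on_of_integral_equation[OF G z eq])
    show "z 0 = x0" using eq[of 0] by simp
  qed
qed

section \<open>Restriction, translation and gluing of solutions\<close>

lemma solution_on_subset: "solution_on F S x \<Longrightarrow> T \<subseteq> S \<Longrightarrow> solution_on F T x"
  unfolding solution_on_def by (meson has_vector_derivative_within_subset subsetD)

lemma solution_on_cong:
  assumes "solution_on F S x" "\<And>t. t \<in> S \<Longrightarrow> y t = x t"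
  shows "solution_on F S y"
  unfolding solution_on_def
proof
  fix t assume t: "t \<in> S"
  have "(x has_vector_derivative F (y t)) (at t within S)"
    using assms t by (simp add: solution_on_def)
  then show "(y has_vector_derivative F (y t)) (at t within S)"
    by (rule has_vector_derivative_transform[rotated 2]) (use assms t in auto)
qed

lemma solution_on_imp_continuous_on: "solution_on F S x \<Longrightarrow> continuous_on S x"
  unfolding solution_on_def continuous_on_eq_continuous_within
  by (blast intro: has_vector_derivative_continuous)

lemma solution_on_shift:
  assumes "solution_on F S x"
  shows "solution_on F ((+) c ` S) (\<lambda>t. x (t - c))"
  unfolding solution_on_def
proof
  fix t assume t: "t \<in> (+) c ` S"
  have "(x has_vector_derivative F (x (t - c))) (at (t - c) within (\<lambda>t. t - c) ` (+) c ` S)"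
    using assms t by (auto simp: solution_on_def image_image)
  moreover have "((\<lambda>t. t - c) has_vector_derivative 1) (at t within (+) c ` S)"
    by (auto intro!: derivative_eq_intros)
  ultimately show "((\<lambda>t. x (t - c)) has_vector_derivative F (x (t - c))) (at t within (+) c ` S)"
    using vector_diff_chain_within[of "\<lambda>t. t - c" 1 t "(+) c ` S" x] by (simp add: o_def)
qed

text \<open>The one-sided derivatives at \<open>b\<close> agree because both are the field at the
  common value. Leaving \<open>S\<close> general covers gluing a bounded interval as well as a
  half-line.\<close>

lemma solution_on_concat:
  assumes x: "solution_on F {a..b} x" and y: "solution_on F S y" and S: "closed S" "S \<subseteq> {b..}" "b \<in> S"
    and ab: "a \<le> b" and eq: "x b = y b"
  shows "solution_on F ({a..b} \<union> S) (\<lambda>t. if t \<in> {a..b} then x t else y t)"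
  unfolding solution_on_def
proof
  fix t assume t: "t \<in> {a..b} \<union> S"
  have int: "{a..b} \<inter> S = {b}" using S ab by force
  have "((\<lambda>t. if t \<in> {a..b} then x t else y t) has_vector_derivative
      (if t \<in> {a..b} then F (x t) else F (y t))) (at t within {a..b} \<union> S)"
  proof (rule has_vector_derivative_If_within_closures[OF t refl])
    have cl: "closure {a..b} \<inter> closure S = {b}" using S int by simp
    show "(x has_vector_derivative F (x t)) (at t within {a..b} \<union> closure {a..b} \<inter> closure S)"
      if "t \<in> {a..b} \<union> closure {a..b} \<inter> closure S"
      using that x ab unfolding cl by (auto simp: solution_on_def insert_absorb)
    show "(y has_vector_derivative F (y t)) (at t within S \<union> closure {a..b} \<inter> closure S)"
      if "t \<in> S \<union> closure {a..b} \<inter> closure S"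
      using that y S(3) unfolding cl by (auto simp: solution_on_def insert_absorb)
    show "x t = y t" "F (x t) = F (y t)" if "t \<in> closure {a..b}" "t \<in> closure S"
    proof -
      have "t = b" using that cl by blast
      then show "x t = y t" "F (x t) = F (y t)" using eq by simp_all
    qed
  qed
  then show "((\<lambda>t. if t \<in> {a..b} then x t else y t) has_vector_derivative
      F (if t \<in> {a..b} then x t else y t)) (at t within {a..b} \<union> S)"
    by (simp add: if_distrib)
qed

text \<open>The global bound allows a restart on a unit interval from any state. Dependent choice
  makes each stage extend the previous one, so the stages have a common extension.\<close>

lemma peano_existence_half_line:
  fixes G :: "real ^ 'n \<Rightarrow> real ^ 'n"
  assumes G: "continuous_on UNIV G" and M: "\<And>x. norm (G x) \<le> M"
  obtains x where "trajectory G x0 x"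
proof -
  have "\<exists>X. \<forall>n. (solution_on G {0..real n} (X n) \<and> X n 0 = x0) \<and> (\<forall>t\<in>{0..real n}. X (Suc n) t = X n t)"
  proof (rule dependent_nat_choice)
    \<comment> \<open>On the one-point interval the filter \<open>at 0 within {0}\<close> is
      trivial, so the constant function counts as a solution.\<close>
    show "\<exists>x. solution_on G {0..real 0} x \<and> x 0 = x0"
      by (intro exI[of _ "\<lambda>t. x0"]) (simp add: solution_on_def has_vector_derivative_def has_derivative_def
          bounded_linear_scaleR_left at_within_eq_bot_iff[of 0 "{0::real}", simplified])
    fix x n assume x: "solution_on G {0..real n} x \<and> x 0 = x0"
    obtain z where z: "solution_on G {0..1} z" "z 0 = x (real n)"
      using peano_existence_unit_interval[OF G M] .
    have "solution_on G {real n..real (Suc n)} (\<lambda>t. z (t - real n))"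
      using solution_on_shift[OF z(1), of "real n"] by (simp add: add.commute)
    from solution_on_concat[OF conjunct1[OF x] this] z
    have "solution_on G ({0..real n} \<union> {real n..real (Suc n)})
        (\<lambda>t. if t \<in> {0..real n} then x t else z (t - real n))" by auto
    also have "{0..real n} \<union> {real n..real (Suc n)} = {0..real (Suc n)}" by auto
    finally show "\<exists>y. (solution_on G {0..real (Suc n)} y \<and> y 0 = x0) \<and> (\<forall>t\<in>{0..real n}. y t = x t)"
      using x by (intro exI[of _ "\<lambda>t. if t \<in> {0..real n} then x t else z (t - real n)"]) auto
  qed
  then obtain X where X: "\<And>n. solution_on G {0..real n} (X n)" "\<And>n. X n 0 = x0"
    and step: "\<And>n t. t \<in> {0..real n} \<Longrightarrow> X (Suc n) t = X n t" by blast
  have agree: "X m t = X n t" if "t \<in> {0..real n}" "n \<le> m" for m n t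
    using that(2) by (induction rule: dec_induct) (use step that(1) in auto)
  define x where "x t = X (nat \<lceil>t\<rceil>) t" for t
  have x: "x t = X n t" if "t \<in> {0..real n}" for t n
    unfolding x_def using that by (intro agree[symmetric]) (auto simp: nat_le_iff ceiling_le_iff)
  have "(x has_vector_derivative G (x t)) (at t within {0..})" if t: "t \<in> {0..}" for t
  proof -
    \<comment> \<open>The successor puts \<open>t\<close> strictly below \<open>n\<close>; only then
      do the derivatives within \<open>{0..real n}\<close> and within \<open>{0..}\<close> coincide,
      as \<open>t\<close> may be an integer.\<close>
    define n where "n = Suc (nat \<lceil>t\<rceil>)"
    have n: "t < real n" using t unfolding n_def by (simp add: nat_less_real_le) linarith
    have "solution_on G {0..real n} x"
      by (rule solution_on_cong[OF X(1) x])
    then have "(x has_vector_derivative G (x t)) (at t within {0..real n})"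
      using t n by (auto simp: solution_on_def)
    moreover have "at t within {0..real n} = at t within {0..}"
      by (rule at_within_nhd[of _ "{..<real n}"]) (use n in auto)
    ultimately show ?thesis by simp
  qed
  moreover have "x 0 = x0" using X(2) by (simp add: x_def)
  ultimately show ?thesis by (intro that[of x]) (auto simp: trajectory_def solution_on_def)
qed

section \<open>Lyapunov's theorem for continuous vector fields\<close>

lemma has_derivative_gradient:
  fixes V :: "real ^ 'n \<Rightarrow> real"
  assumes "V differentiable (at x)"
  shows "(V has_derivative (\<lambda>h. gradient V x \<bullet> h)) (at x)"
proof -
  have D: "(V has_derivative frechet_derivative V (at x)) (at x)"
    using assms by (simp add: frechet_derivative_works)
  then interpret bounded_linear "frechet_derivative V (at x)" by (rule has_derivative_bounded_linear)
  have "frechet_derivative V (at x) h = gradient V x \<bullet> h" for h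
  proof -
    have "frechet_derivative V (at x) h = frechet_derivative V (at x) (\<Sum>i\<in>UNIV. h $ i *\<^sub>R axis i 1)"
      by (simp add: basis_expansion[of h, unfolded scalar_mult_eq_scaleR])
    also have "\<dots> = gradient V x \<bullet> h"
      by (simp add: sum scaleR gradient_def inner_vec_def mult.commute)
    finally show ?thesis .
  qed
  with D show ?thesis by (metis (no_types, lifting) ext)
qed

lemma class_P_C1: "V \<in> class_P \<Longrightarrow> V \<in> C1"
  by (simp add: class_P_def)

lemma C1_continuous_on: "V \<in> C1 \<Longrightarrow> continuous_on S V"
  by (rule differentiable_imp_continuous_on) (auto simp: C1_def differentiable_on_def intro: differentiable_at_withinI)

lemma class_P_zero: "V \<in> class_P \<Longrightarrow> V 0 = 0"
  by (simp add: class_P_def pos_def_fun_def)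

lemma class_P_pos: "V \<in> class_P \<Longrightarrow> x \<noteq> 0 \<Longrightarrow> 0 < V x"
  by (simp add: class_P_def pos_def_fun_def)

lemma class_P_nonneg: "V \<in> class_P \<Longrightarrow> 0 \<le> V x"
  by (cases "x = 0") (auto simp: class_P_zero class_P_pos less_imp_le)

text \<open>The origin is a global minimum of \<open>V\<close>. Hence the policy of \<open>V\<close>
  vanishes there and the origin is an equilibrium of its closed loop.\<close>

lemma class_P_gradient_zero:
  assumes "V \<in> class_P"
  shows "gradient V 0 = 0"
proof -
  have "(V has_derivative (\<lambda>h. gradient V 0 \<bullet> h)) (at 0)"
    using assms by (intro has_derivative_gradient) (auto simp: class_P_def C1_def)
  moreover have "\<forall>y\<in>ball 0 1. V 0 \<le> V y"
    using class_P_nonneg[OF assms] class_P_zero[OF assms] by simp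
  ultimately have "(\<lambda>h. gradient V 0 \<bullet> h) = (\<lambda>h. 0)"
    using differential_zero_maxmin[of 0 "ball 0 1" V] by auto
  then show ?thesis by (metis inner_eq_zero_iff)
qed

text \<open>Properness enters here: it turns a bound on \<open>V\<close> along a solution into a
  bound on the state.\<close>

lemma class_P_sublevel_bounded:
  assumes "V \<in> class_P"
  obtains r where "r > 0" "\<And>x. r \<le> norm x \<Longrightarrow> c < V x"
proof -
  have "\<forall>\<^sub>F x in at_infinity. c < V x"
    using assms by (auto simp: class_P_def proper_fun_def filterlim_at_top_dense)
  then obtain b where "\<And>x. b \<le> norm x \<Longrightarrow> c < V x" by (auto simp: eventually_at_infinity)
  then show ?thesis by (intro that[of "max b 1"]) auto
qed

lemma C1_along_solution:
  assumes "V \<in> C1" "solution_on F S x" "t \<in> S"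
  shows "((\<lambda>t. V (x t)) has_vector_derivative (gradient V (x t) \<bullet> F (x t))) (at t within S)"
proof -
  have "(V has_derivative (\<lambda>h. gradient V (x t) \<bullet> h)) (at (x t))"
    using assms by (intro has_derivative_gradient) (auto simp: C1_def)
  moreover have "(x has_derivative (\<lambda>h. h *\<^sub>R F (x t))) (at t within S)"
    using assms by (auto simp: solution_on_def has_vector_derivative_def)
  ultimately have "((\<lambda>t. V (x t)) has_derivative (\<lambda>h. gradient V (x t) \<bullet> (h *\<^sub>R F (x t)))) (at t within S)"
    using has_derivative_compose by blast
  then show ?thesis by (simp add: has_vector_derivative_def)
qed

lemma C1_along_solution_has_integral:
  assumes "V \<in> C1" "solution_on F {a..b} x" "a \<le> b"
  shows "((\<lambda>t. gradient V (x t) \<bullet> F (x t)) has_integral (V (x b) - V (x a))) {a..b}"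
  by (rule fundamental_theorem_of_calculus[OF assms(3) C1_along_solution[OF assms(1,2)]])

lemma C1_along_solution_le:
  assumes V: "V \<in> C1" and x: "solution_on F {a..b} x" and ab: "a \<le> b"
    and le: "\<And>t. t \<in> {a..b} \<Longrightarrow> gradient V (x t) \<bullet> F (x t) \<le> - c"
  shows "V (x b) \<le> V (x a) - c * (b - a)"
proof -
  have "((\<lambda>t. - c) has_integral (b - a) *\<^sub>R (- c)) {a..b}"
    using has_integral_const_real[of "- c" a b] ab by simp
  from has_integral_le[OF C1_along_solution_has_integral[OF V x ab] this le]
  show ?thesis by (simp add: algebra_simps)
qed

section \<open>Trapping, global existence, stability and attractivity\<close>

lemma norm_IVT:
  fixes x :: "real \<Rightarrow> 'a::real_normed_vector"
  assumes "continuous_on {a..b} x" "a \<le> b" "norm (x a) < r" "r \<le> norm (x b)"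
  obtains s where "s \<in> {a..b}" "norm (x s) = r"
  using IVT'[of "\<lambda>t. norm (x t)" a r b] assms by (auto intro: continuous_on_norm)

text \<open>Up to the first time on the sphere the solution stays in the ball, so \<open>V\<close>
  cannot rise to the values it has on the sphere. Decrease is assumed only inside the ball, so that
  the lemma applies to a field truncated outside it.\<close>

lemma lyapunov_trapping:
  assumes V: "V \<in> C1" and x: "solution_on F {0..T} x" and x0: "norm (x 0) < r"
    and dec: "\<And>p. norm p \<le> r \<Longrightarrow> gradient V p \<bullet> F p \<le> 0"
    and sphere: "\<And>p. norm p = r \<Longrightarrow> V (x 0) < V p"
    and t: "t \<in> {0..T}"
  shows "norm (x t) < r"
proof (rule ccontr)
  assume "\<not> norm (x t) < r"
  then have ge: "r \<le> norm (x t)" by simp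
  have cont: "continuous_on {0..s} x" if "s \<le> t" for s
    using continuous_on_subset[OF solution_on_imp_continuous_on[OF x]] t that by auto
  \<comment> \<open>The hitting times of the sphere form a closed nonempty set, so a first one
    exists and is \<open>Inf B\<close>.\<close>
  define B where "B = {s \<in> {0..t}. norm (x s) = r}"
  have "B \<noteq> {}"
    using norm_IVT[OF cont[OF order_refl] _ x0 ge] t by (auto simp: B_def)
  moreover have "closed B"
    unfolding B_def using continuous_closed_preimage_constant[of "{0..t}" "\<lambda>s. norm (x s)" r]
      continuous_on_norm[OF cont[OF order_refl]] by simp
  moreover have bdd: "bdd_below B" by (auto simp: B_def intro: bdd_belowI[of _ 0])
  ultimately have s: "Inf B \<in> B" by (intro closed_contains_Inf)
  \<comment> \<open>Leaving the ball before \<open>Inf B\<close> would, by the intermediate value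
    theorem, produce a hitting time that is too early.\<close>
  have le: "norm (x u) \<le> r" if "u \<in> {0..Inf B}" for u
  proof (rule ccontr)
    assume "\<not> norm (x u) \<le> r"
    then have u: "r < norm (x u)" by simp
    have ut: "u \<le> t" and u0: "0 \<le> u" using that s by (auto simp: B_def)
    obtain v where v: "v \<in> {0..u}" "norm (x v) = r"
      using norm_IVT[OF cont[OF ut] u0 x0 less_imp_le[OF u]] .
    then have "v \<in> B" using ut by (auto simp: B_def)
    then have "Inf B \<le> v" using bdd by (rule cInf_lower)
    then have "v = u" using v that by auto
    then show False using u v by simp
  qed
  have "solution_on F {0..Inf B} x"
    using s t by (intro solution_on_subset[OF x]) (auto simp: B_def)
  then have "V (x (Inf B)) \<le> V (x 0) - 0 * (Inf B - 0)"
    using s dec le by (intro C1_along_solution_le[OF V]) (auto simp: B_def)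
  moreover have "V (x 0) < V (x (Inf B))" using s by (intro sphere) (auto simp: B_def)
  ultimately show False by simp
qed

lemma trajectory_shift:
  assumes "trajectory F x0 x" "0 \<le> c"
  shows "trajectory F (x c) (\<lambda>t. x (t + c))"
proof -
  have "solution_on F {c..} x"
    using assms by (auto simp: trajectory_def intro: solution_on_subset)
  from solution_on_shift[OF this, of "- c", unfolded image_add_atLeast] show ?thesis
    by (simp add: trajectory_def)
qed

text \<open>Projecting onto a large ball before applying \<open>F\<close> gives a bounded continuous
  field, to which Peano applies for all time. Trapping keeps the trajectory in the ball, where the
  projection is the identity.\<close>

lemma lyapunov_trajectory_exists:
  assumes F: "continuous_on UNIV F" and V: "V \<in> class_P"
    and dec: "\<And>p. gradient V p \<bullet> F p \<le> 0"
  obtains x where "trajectory F x0 x"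
proof -
  obtain r where r: "r > 0" "\<And>p. r \<le> norm p \<Longrightarrow> V x0 < V p"
    using class_P_sublevel_bounded[OF V, of "V x0"] by blast
  define P where "P = closest_point (cball (0::real^'a) r)"
  have P: "norm (P p) \<le> r" for p
    using closest_point_in_set[of "cball 0 r" p] r by (auto simp: P_def)
  have P_id: "P p = p" if "norm p \<le> r" for p
    using that by (simp add: P_def closest_point_self)
  have contP: "continuous_on UNIV P"
    unfolding P_def using r by (intro continuous_on_closest_point) auto
  have "bounded (F ` cball 0 r)"
    by (intro compact_imp_bounded compact_continuous_image continuous_on_subset[OF F]) auto
  then obtain M where M: "\<And>p. norm p \<le> r \<Longrightarrow> norm (F p) \<le> M"
    by (metis bounded_iff imageI mem_cball_0)
  obtain x where x: "trajectory (\<lambda>p. F (P p)) x0 x"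
  proof (rule peano_existence_half_line)
    show "continuous_on UNIV (\<lambda>p. F (P p))" by (rule continuous_on_compose2[OF F contP]) auto
    show "norm (F (P p)) \<le> M" for p by (rule M[OF P])
  qed
  have x0: "x 0 = x0" and sol: "solution_on (\<lambda>p. F (P p)) {0..} x"
    using x by (auto simp: trajectory_def)
  have small: "norm (x t) < r" if "t \<ge> 0" for t
  proof (rule lyapunov_trapping[OF class_P_C1[OF V]])
    show "solution_on (\<lambda>p. F (P p)) {0..t} x" by (rule solution_on_subset[OF sol]) auto
    show "norm (x 0) < r" using r(2)[of x0] x0 by (meson less_irrefl not_le)
    show "gradient V p \<bullet> F (P p) \<le> 0" if "norm p \<le> r" for p using dec that by (simp add: P_id)
    show "V (x 0) < V p" if "norm p = r" for p using r that x0 by simp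
  qed (use that in auto)
  have "P (x t) = x t" if "t \<ge> 0" for t using small[OF that] by (intro P_id) simp
  with sol have "solution_on F {0..} x" by (simp add: solution_on_def)
  with x0 show ?thesis by (intro that[of x]) (simp add: trajectory_def)
qed

text \<open>Bounded speed makes \<open>y\<close> Lipschitz, hence uniformly continuous, so it has a
  limit at \<open>T\<close>. Differentiability at \<open>T\<close> is recovered from the integral
  equation.\<close>

lemma solution_on_extend_closed:
  assumes F: "continuous_on UNIV F" and y: "solution_on F {0..<T} y" and T: "0 < T"
    and B: "\<And>t. t \<in> {0..<T} \<Longrightarrow> norm (F (y t)) \<le> B"
  obtains z where "solution_on F {0..T} z" "\<And>t. t \<in> {0..<T} \<Longrightarrow> z t = y t"
proof -
  have B0: "0 \<le> B" using B[of 0] T norm_ge_zero[of "F (y 0)"] by (simp del: norm_ge_zero)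
  have "B-lipschitz_on {0..<T} y"
  proof (rule bounded_derivative_imp_lipschitz)
    show "(y has_derivative (\<lambda>h. h *\<^sub>R F (y t))) (at t within {0..<T})" if "t \<in> {0..<T}" for t
      using y that by (auto simp: solution_on_def has_vector_derivative_def)
    show "onorm (\<lambda>h. h *\<^sub>R F (y t)) \<le> B" if "t \<in> {0..<T}" for t
      using B[OF that] by (intro onorm_le) (metis abs_ge_zero mult.commute mult_left_mono norm_scaleR real_norm_def)
  qed (use B0 in auto)
  then have "uniformly_continuous_on {0..<T} y" by (rule lipschitz_on_uniformly_continuous)
  then obtain z where uz: "uniformly_continuous_on (closure {0..<T}) z"
    and z: "\<And>t. t \<in> {0..<T} \<Longrightarrow> y t = z t"
    by (rule uniformly_continuous_on_extension_on_closure) blast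
  have cl: "closure {0..<T} = {0..T}" using T by simp
  have cz: "continuous_on {0..T} z"
    using uniformly_continuous_imp_continuous[OF uz] cl by simp
  have sol: "solution_on F {0..<T} z" by (rule solution_on_cong[OF y z[symmetric]])
  have cFz: "continuous_on {0..T} (\<lambda>s. F (z s))" by (rule continuous_on_compose2[OF F cz]) auto
  \<comment> \<open>The difference is constant on \<open>{0..<T}\<close> by the fundamental theorem,
    and by continuity still constant at \<open>T\<close>.\<close>
  have "z t - integral {0..t} (\<lambda>s. F (z s)) = z 0" if "t \<in> {0..T}" for t
  proof (rule continuous_constant_on_closure[of "{0..<T}" "\<lambda>t. z t - integral {0..t} (\<lambda>s. F (z s))"])
    show "continuous_on (closure {0..<T}) (\<lambda>t. z t - integral {0..t} (\<lambda>s. F (z s)))"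
      unfolding cl by (intro continuous_on_diff cz indefinite_integral_continuous_1 integrable_continuous_real cFz)
    show "t \<in> closure {0..<T}" using that cl by simp
    fix s assume s: "s \<in> {0..<T}"
    have "((\<lambda>s. F (z s)) has_integral (z s - z 0)) {0..s}"
    proof (rule fundamental_theorem_of_calculus)
      have "solution_on F {0..s} z" using s by (intro solution_on_subset[OF sol]) auto
      then show "(z has_vector_derivative F (z u)) (at u within {0..s})" if "u \<in> {0..s}" for u
        using that by (simp add: solution_on_def)
    qed (use s in auto)
    then show "z s - integral {0..s} (\<lambda>s. F (z s)) = z 0" by (simp add: integral_unique)
  qed
  then have "z t = z 0 + integral {0..t} (\<lambda>s. F (z s))" if "t \<in> {0..T}" for t
    using that by (metis diff_add_cancel)
  from solution_on_of_integral_equation[OF F cz this] show ?thesis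
    by (rule that) (use z in auto)
qed

text \<open>A solution on \<open>{0..<T}\<close> stays in a bounded sublevel set, so its speed is
  bounded and it reaches time \<open>T\<close>; a trajectory starting from its endpoint is glued
  on.\<close>

lemma lyapunov_forward_complete:
  assumes F: "continuous_on UNIV F" and V: "V \<in> class_P"
    and dec: "\<And>p. gradient V p \<bullet> F p \<le> 0"
  shows "forward_complete F"
  unfolding forward_complete_def
proof (intro conjI allI impI)
  show "\<exists>x. trajectory F x0 x" for x0
    using lyapunov_trajectory_exists[OF F V dec] by blast
  fix T :: real and y assume T: "0 < T" and y: "solution_on F {0..<T} y"
  obtain r where r: "r > 0" "\<And>p. r \<le> norm p \<Longrightarrow> V (y 0) < V p"
    using class_P_sublevel_bounded[OF V, of "V (y 0)"] by blast
  have small: "norm (y t) \<le> r" if "t \<in> {0..<T}" for t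
  proof (rule ccontr)
    assume "\<not> norm (y t) \<le> r"
    moreover have "solution_on F {0..t} y" using that by (intro solution_on_subset[OF y]) auto
    then have "V (y t) \<le> V (y 0) - 0 * (t - 0)"
      using that dec by (intro C1_along_solution_le[OF class_P_C1[OF V]]) auto
    ultimately show False using r(2)[of "y t"] by simp
  qed
  have "bounded (F ` cball 0 r)"
    by (intro compact_imp_bounded compact_continuous_image continuous_on_subset[OF F]) auto
  then obtain M where M: "\<And>p. norm p \<le> r \<Longrightarrow> norm (F p) \<le> M"
    by (metis bounded_iff imageI mem_cball_0)
  obtain z where z: "solution_on F {0..T} z" "\<And>t. t \<in> {0..<T} \<Longrightarrow> z t = y t"
    using solution_on_extend_closed[OF F y T M[OF small]] by blast
  obtain w where w: "trajectory F (z T) w" using lyapunov_trajectory_exists[OF F V dec] .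
  have "solution_on F {T..} (\<lambda>t. w (t - T))"
    using w solution_on_shift[of F "{0..}" w T] by (simp add: trajectory_def)
  from solution_on_concat[OF z(1) this] T w
  have "solution_on F ({0..T} \<union> {T..}) (\<lambda>t. if t \<in> {0..T} then z t else w (t - T))"
    by (simp add: trajectory_def)
  also have "{0..T} \<union> {T..} = {0..}" using T by auto
  finally show "\<exists>x. solution_on F {0..} x \<and> (\<forall>t\<in>{0..<T}. x t = y t)"
    using z(2) by (intro exI[of _ "\<lambda>t. if t \<in> {0..T} then z t else w (t - T)"]) auto
qed

text \<open>By continuity \<open>V\<close> near the origin lies below its positive minimum on the
  sphere of radius \<open>\<epsilon>\<close>, so trapping applies.\<close>

lemma lyapunov_stable:
  assumes V: "V \<in> class_P" and dec: "\<And>p. gradient V p \<bullet> F p \<le> 0" and \<epsilon>: "0 < \<epsilon>"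
  obtains \<delta> where "0 < \<delta>"
    "\<And>x0 x t. norm x0 < \<delta> \<Longrightarrow> trajectory F x0 x \<Longrightarrow> 0 \<le> t \<Longrightarrow> norm (x t) < \<epsilon>"
proof -
  have contV: "continuous_on S V" for S by (rule C1_continuous_on[OF class_P_C1[OF V]])
  have "sphere (0::real^'a) \<epsilon> \<noteq> {}" using \<epsilon> by simp
  with continuous_attains_inf[of "sphere 0 \<epsilon>" V] contV obtain p0
    where p0: "norm p0 = \<epsilon>" "\<And>p. norm p = \<epsilon> \<Longrightarrow> V p0 \<le> V p" by auto
  have "p0 \<noteq> 0" using p0 \<epsilon> by auto
  then have "0 < V p0" using class_P_pos[OF V] by blast
  moreover have "isCont V 0" using contV[of UNIV] by (simp add: continuous_on_eq_continuous_at)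
  ultimately obtain d where d: "0 < d" "\<And>p. norm p < d \<Longrightarrow> \<bar>V p\<bar> < V p0"
    using class_P_zero[OF V] unfolding continuous_at_eps_delta dist_norm by fastforce
  show ?thesis
  proof (rule that[of "min d \<epsilon>"])
    fix x0 x and t :: real assume x0: "norm x0 < min d \<epsilon>" and x: "trajectory F x0 x" and t: "0 \<le> t"
    show "norm (x t) < \<epsilon>"
    proof (rule lyapunov_trapping[OF class_P_C1[OF V]])
      show "solution_on F {0..t} x" using x by (auto simp: trajectory_def intro: solution_on_subset)
      show "V (x 0) < V p" if "norm p = \<epsilon>" for p
        using p0(2)[OF that] d(2)[of x0] x0 x by (auto simp: trajectory_def)
    qed (use x x0 dec t in \<open>auto simp: trajectory_def\<close>)
  qed (use d \<epsilon> in auto)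
qed

text \<open>By stability it suffices to enter the \<open>\<delta>\<close>-ball once. Otherwise the
  trajectory stays in a compact annulus where \<open>q\<close> has a positive minimum, and
  \<open>V\<close> decreases linearly until it is negative.\<close>

lemma lyapunov_attractive:
  assumes V: "V \<in> class_P" and q: "continuous_on UNIV q" "pos_def_fun q"
    and dec: "\<And>p. gradient V p \<bullet> F p \<le> - q p" and x: "trajectory F x0 x"
  shows "(x \<longlongrightarrow> 0) at_top"
proof (rule tendstoI)
  fix \<epsilon> :: real assume "0 < \<epsilon>"
  have q0: "0 \<le> q p" for p using q(2) by (cases "p = 0") (auto simp: pos_def_fun_def less_imp_le)
  have dec0: "gradient V p \<bullet> F p \<le> 0" for p using dec[of p] q0[of p] by simp
  obtain \<delta> where \<delta>: "0 < \<delta>"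
    "\<And>x0 x t. norm x0 < \<delta> \<Longrightarrow> trajectory F x0 x \<Longrightarrow> 0 \<le> t \<Longrightarrow> norm (x t) < \<epsilon>"
    using lyapunov_stable[where F = F, OF V dec0 \<open>0 < \<epsilon>\<close>] by blast
  have sol: "solution_on F {0..t} x" for t using x by (auto simp: trajectory_def intro: solution_on_subset)
  obtain r where r: "r > 0" "\<And>p. r \<le> norm p \<Longrightarrow> V x0 < V p"
    using class_P_sublevel_bounded[OF V, of "V x0"] by blast
  have small: "norm (x t) \<le> r" if "0 \<le> t" for t
  proof (rule ccontr)
    assume "\<not> norm (x t) \<le> r"
    moreover have "V (x t) \<le> V (x 0) - 0 * (t - 0)"
      using that dec0 by (intro C1_along_solution_le[OF class_P_C1[OF V] sol]) auto
    ultimately show False using r(2)[of "x t"] x by (simp add: trajectory_def)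
  qed
  have "\<exists>c\<ge>0. norm (x c) < \<delta>"
  proof (rule ccontr)
    assume "\<not> (\<exists>c\<ge>0. norm (x c) < \<delta>)"
    then have big: "\<delta> \<le> norm (x t)" if "0 \<le> t" for t using that by (meson not_le)
    define K where "K = {p :: real^'a. norm p \<le> r \<and> \<delta> \<le> norm p}"
    have "K = cball 0 r - ball 0 \<delta>" by (auto simp: K_def)
    then have "compact K" by (simp add: compact_diff)
    moreover have xK: "x t \<in> K" if "0 \<le> t" for t using small big that by (simp add: K_def)
    ultimately obtain p where p: "p \<in> K" "\<And>p'. p' \<in> K \<Longrightarrow> q p \<le> q p'"
      using continuous_attains_inf[of K q] continuous_on_subset[OF q(1)] by blast
    have "p \<noteq> 0" using p(1) \<delta>(1) by (auto simp: K_def)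
    then have qp: "0 < q p" using q(2) by (simp add: pos_def_fun_def)
    \<comment> \<open>At this time the linear bound \<open>V x0 - q p * T\<close> equals -1.\<close>
    define T where "T = (V x0 + 1) / q p"
    have T: "0 \<le> T" using qp class_P_nonneg[OF V, of x0] by (simp add: T_def)
    have "V (x T) \<le> V (x 0) - q p * (T - 0)"
    proof (rule C1_along_solution_le[OF class_P_C1[OF V] sol T])
      show "gradient V (x t) \<bullet> F (x t) \<le> - q p" if "t \<in> {0..T}" for t
        using dec[of "x t"] p(2)[OF xK[of t]] that by simp
    qed
    also have "\<dots> = - 1" using x qp by (simp add: T_def trajectory_def)
    finally show False using class_P_nonneg[OF V, of "x T"] by simp
  qed
  then obtain c where c: "0 \<le> c" "norm (x c) < \<delta>" by blast
  have "norm (x t) < \<epsilon>" if "c \<le> t" for t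
    using \<delta>(2)[OF c(2) trajectory_shift[OF x c(1)], of "t - c"] that by simp
  then show "\<forall>\<^sub>F t in at_top. dist (x t) 0 < \<epsilon>"
    by (auto simp: eventually_at_top_linorder)
qed

theorem lyapunov_GAS:
  assumes F: "continuous_on UNIV F" "F 0 = 0" and V: "V \<in> class_P"
    and q: "continuous_on UNIV q" "pos_def_fun q"
    and dec: "\<And>p. gradient V p \<bullet> F p \<le> - q p"
  shows "GAS_at_origin F"
proof -
  have "0 \<le> q p" for p using q(2) by (cases "p = 0") (auto simp: pos_def_fun_def less_imp_le)
  then have dec0: "gradient V p \<bullet> F p \<le> 0" for p using dec[of p] by (meson neg_le_0_iff_le order_trans)
  show ?thesis
    unfolding GAS_at_origin_def
  proof (intro conjI allI impI)
    fix \<epsilon> :: real assume "0 < \<epsilon>"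
    then show "\<exists>\<delta>>0. \<forall>x0 x. norm x0 < \<delta> \<longrightarrow> trajectory F x0 x \<longrightarrow> (\<forall>t\<ge>0. norm (x t) < \<epsilon>)"
      using lyapunov_stable[where F = F, OF V dec0, of \<epsilon>] by metis
  qed (use F lyapunov_forward_complete[OF F(1) V dec0] lyapunov_attractive[OF V q dec] in auto)
qed

section \<open>Matrices and integrals\<close>

lemma continuous_on_matrix_vector_mult:
  fixes A :: "'a::topological_space \<Rightarrow> real ^ 'm ^ 'n"
  assumes "continuous_on S A" "continuous_on S b"
  shows "continuous_on S (\<lambda>x. A x *v b x)"
  unfolding matrix_vector_mult_def
  by (intro continuous_intros continuous_on_vec_lambda continuous_on_component assms)

lemma continuous_on_transpose:
  fixes A :: "'a::topological_space \<Rightarrow> real ^ 'm ^ 'n"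
  assumes "continuous_on S A"
  shows "continuous_on S (\<lambda>x. transpose (A x))"
  unfolding transpose_def
  by (intro continuous_on_vec_lambda continuous_on_component assms)

lemma continuous_on_det:
  fixes A :: "'a::topological_space \<Rightarrow> real ^ 'n ^ 'n"
  assumes "continuous_on S A"
  shows "continuous_on S (\<lambda>x. det (A x))"
  unfolding det_def by (intro continuous_intros continuous_on_component assms)

lemma matrix_inv_works:
  assumes "invertible A"
  shows "A ** matrix_inv A = mat 1" "matrix_inv A ** A = mat 1"
  using someI_ex[OF assms[unfolded invertible_def]] unfolding matrix_inv_def by auto

lemma matrix_inv_mult_vector:
  fixes A :: "real ^ 'n ^ 'n"
  assumes "invertible A"
  shows "A *v (matrix_inv A *v b) = b"
  by (simp add: matrix_vector_mul_assoc matrix_inv_works[OF assms])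

text \<open>Cramer's rule writes the components as quotients of determinants, which are continuous
  in the entries.\<close>

lemma continuous_on_matrix_inv_mult_vector:
  fixes A :: "'a::topological_space \<Rightarrow> real ^ 'n ^ 'n"
  assumes A: "continuous_on S A" and b: "continuous_on S b" and inv: "\<And>x. x \<in> S \<Longrightarrow> invertible (A x)"
  shows "continuous_on S (\<lambda>x. matrix_inv (A x) *v b x)"
proof -
  have "continuous_on S (\<lambda>x. \<chi> k. det (\<chi> i j. if j = k then b x $ i else A x $ i $ j) / det (A x))"
  proof (intro continuous_on_vec_lambda continuous_on_divide continuous_on_det A ballI)
    show "continuous_on S (\<lambda>x. if j = k then b x $ i else A x $ i $ j)" for i j k
      by (cases "j = k") (simp_all add: continuous_on_component A b)
    show "det (A x) \<noteq> 0" if "x \<in> S" for x using inv[OF that] by (simp add: invertible_det_nz)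
  qed
  then show ?thesis
  proof (rule continuous_on_eq)
    fix x assume "x \<in> S"
    then show "(\<chi> k. det (\<chi> i j. if j = k then b x $ i else A x $ i $ j) / det (A x)) = matrix_inv (A x) *v b x"
      using inv[of x] cramer[of "A x" "matrix_inv (A x) *v b x" "b x"]
      by (simp add: invertible_det_nz matrix_inv_mult_vector)
  qed
qed

lemma sym_pos_def_invertible:
  assumes "sym_pos_def A"
  shows "invertible A"
proof -
  have "x = 0" if "A *v x = 0" for x
    using assms that unfolding sym_pos_def_def by (metis inner_zero_right less_irrefl)
  then show ?thesis by (simp add: invertible_left_inverse matrix_left_invertible_ker)
qed

lemma sym_pos_def_inner_commute:
  assumes "sym_pos_def A"
  shows "u \<bullet> (A *v w) = w \<bullet> (A *v u)"
  using assms unfolding sym_pos_def_def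
  by (metis dot_lmul_matrix inner_commute transpose_matrix_vector)

lemma sym_pos_def_inner_nonneg: "sym_pos_def A \<Longrightarrow> 0 \<le> u \<bullet> (A *v u)"
  unfolding sym_pos_def_def by (cases "u = 0") (auto simp: less_imp_le)

text \<open>Monotone convergence along \<open>{0..real n}\<close> carries a bound on gauge
  integrals, uniform in \<open>T\<close>, to the Lebesgue integral over the half-line.\<close>

lemma nn_integral_half_line_le:
  fixes h :: "real \<Rightarrow> real"
  assumes h: "continuous_on {0..} h" and nn: "\<And>t. 0 \<le> t \<Longrightarrow> 0 \<le> h t"
    and C: "\<And>T. 0 \<le> T \<Longrightarrow> integral {0..T} h \<le> C"
  shows "(\<integral>\<^sup>+t\<in>{0..}. ennreal (h t) \<partial>lborel) \<le> ennreal C"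
proof -
  have "(\<lambda>n. \<integral>\<^sup>+t\<in>{0..real n}. ennreal (h t) \<partial>lborel) \<longlonglongrightarrow> (\<integral>\<^sup>+t\<in>{0..}. ennreal (h t) \<partial>lborel)"
  proof (rule nn_integral_LIMSEQ)
    show "incseq (\<lambda>n t. ennreal (h t) * indicator {0..real n} t)"
      by (auto simp: incseq_def le_fun_def indicator_def)
    fix n
    have "(\<lambda>t. indicator {0..real n} t *\<^sub>R h t) \<in> borel_measurable borel"
      by (intro borel_measurable_continuous_on_indicator continuous_on_subset[OF h]) auto
    then have "(\<lambda>t. ennreal (indicator {0..real n} t *\<^sub>R h t)) \<in> borel_measurable lborel" by measurable
    also have "(\<lambda>t. ennreal (indicator {0..real n} t *\<^sub>R h t)) = (\<lambda>t. ennreal (h t) * indicator {0..real n} t)"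
      by (auto simp: indicator_def)
    finally show "(\<lambda>t. ennreal (h t) * indicator {0..real n} t) \<in> borel_measurable lborel" .
  next
    fix t :: real
    show "(\<lambda>n. ennreal (h t) * indicator {0..real n} t) \<longlonglongrightarrow> ennreal (h t) * indicator {0..} t"
    proof (rule tendsto_eventually, rule eventually_sequentiallyI[of "nat \<lceil>t\<rceil>"])
      fix n assume "nat \<lceil>t\<rceil> \<le> n"
      then have "t \<le> real n" by (simp add: nat_le_iff ceiling_le_iff)
      then show "ennreal (h t) * indicator {0..real n} t = ennreal (h t) * indicator {0..} t"
        by (simp add: indicator_def)
    qed
  qed
  moreover have "(\<integral>\<^sup>+t\<in>{0..real n}. ennreal (h t) \<partial>lborel) \<le> ennreal C" for n
  proof -
    have "(h has_integral integral {0..real n} h) {0..real n}"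
      by (intro integrable_integral integrable_continuous_real continuous_on_subset[OF h]) auto
    then have "(\<integral>\<^sup>+t\<in>{0..real n}. ennreal (h t) \<partial>lborel) = ennreal (integral {0..real n} h)"
      by (intro nn_integral_has_integral_lebesgue') (auto simp: nn)
    also have "\<dots> \<le> ennreal C" by (intro ennreal_leI C) simp
    finally show ?thesis .
  qed
  ultimately show ?thesis by (intro LIMSEQ_le_const2) auto
qed

lemma nn_integral_half_line_ge:
  fixes h :: "real \<Rightarrow> real"
  assumes h: "continuous_on {0..} h" and nn: "\<And>t. 0 \<le> t \<Longrightarrow> 0 \<le> h t"
  shows "ennreal (integral {0..T} h) \<le> (\<integral>\<^sup>+t\<in>{0..}. ennreal (h t) \<partial>lborel)"
proof -
  have "(h has_integral integral {0..T} h) {0..T}"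
    by (intro integrable_integral integrable_continuous_real continuous_on_subset[OF h]) auto
  then have "ennreal (integral {0..T} h) = (\<integral>\<^sup>+t\<in>{0..T}. ennreal (h t) \<partial>lborel)"
    by (intro nn_integral_has_integral_lebesgue'[symmetric]) (auto simp: nn)
  also have "\<dots> \<le> (\<integral>\<^sup>+t\<in>{0..}. ennreal (h t) \<partial>lborel)"
    by (intro nn_integral_mono) (auto simp: indicator_def)
  finally show ?thesis .
qed

lemma integrable_on_compact_continuous:
  fixes h :: "'a::euclidean_space \<Rightarrow> 'b::euclidean_space"
  assumes "compact S" "continuous_on S h"
  shows "h integrable_on S"
  using borel_integrable_compact[OF assms] by (intro set_borel_integral_eq_integral(1)) (simp add: set_integrable_def)

section \<open>The relaxed Hamilton-Jacobi-Bellman inequality\<close>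

locale affine_control_problem =
  fixes f :: "real ^ 'n \<Rightarrow> real ^ 'n"
    and g :: "real ^ 'n \<Rightarrow> real ^ 'm ^ 'n"
    and q :: "real ^ 'n \<Rightarrow> real"
    and R :: "real ^ 'n \<Rightarrow> real ^ 'm ^ 'm"
  assumes cont_f: "continuous_on UNIV f" and f0: "f 0 = 0"
    and cont_g: "continuous_on UNIV g"
    and cont_q: "continuous_on UNIV q" and pos_q: "pos_def_fun q"
    and cont_R: "continuous_on UNIV R" and pos_R: "\<And>x. sym_pos_def (R x)"
begin

lemma running_cost_ge: "q x \<le> running_cost q R x u"
  using sym_pos_def_inner_nonneg[OF pos_R] by (simp add: running_cost_def)

lemma running_cost_nonneg: "0 \<le> running_cost q R x u"
proof -
  have "0 \<le> q x" using pos_q by (cases "x = 0") (auto simp: pos_def_fun_def less_imp_le)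
  then show ?thesis using running_cost_ge by (rule order_trans)
qed

text \<open>Since \<open>R x\<close> times the policy is minus one half of the transposed
  \<open>g x\<close> applied to the gradient, the control term becomes a pairing in
  \<open>R x\<close>, free of the matrix inverse.\<close>

lemma gradient_inner_control:
  "gradient V x \<bullet> (g x *v w) = - 2 * (w \<bullet> (R x *v policy g R V x))"
proof -
  have "R x *v policy g R V x = - (1 / 2) *\<^sub>R (transpose (g x) *v gradient V x)"
    unfolding policy_def matrix_vector_mult_scaleR
    by (simp only: matrix_inv_mult_vector[OF sym_pos_def_invertible[OF pos_R]])
  moreover have "gradient V x \<bullet> (g x *v w) = w \<bullet> (transpose (g x) *v gradient V x)"
    by (simp add: dot_lmul_matrix[symmetric] inner_commute)
  ultimately show ?thesis by simp
qed

text \<open>The inverse in the quadratic term is absorbed by taking \<open>w\<close> to be -2 times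
  the policy in \<open>gradient_inner_control\<close>.\<close>

lemma op_H_policy:
  "op_H f g q R V x = gradient V x \<bullet> f x + q x - policy g R V x \<bullet> (R x *v policy g R V x)"
proof -
  have "matrix_inv (R x) *v (transpose (g x) *v gradient V x) = - 2 *\<^sub>R policy g R V x"
    by (simp add: policy_def)
  then have "op_H f g q R V x = gradient V x \<bullet> f x + q x - 1 / 4 * (gradient V x \<bullet> (g x *v (- 2 *\<^sub>R policy g R V x)))"
    unfolding op_H_def by (simp only:)
  then show ?thesis
    by (simp only: gradient_inner_control) simp
qed

text \<open>Symmetry of \<open>R x\<close> merges the two cross terms of the completed
  square.\<close>

lemma derivative_along_closed_loop:
  "gradient V x \<bullet> closed_loop f g w x = op_H f g q R V x - running_cost q R x (w x)
     + (w x - policy g R V x) \<bullet> (R x *v (w x - policy g R V x))"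
  using sym_pos_def_inner_commute[OF pos_R, of "policy g R V x" x "w x"]
  by (simp add: closed_loop_def op_H_policy running_cost_def gradient_inner_control inner_right_distrib
      matrix_vector_mult_diff_distrib inner_diff_left inner_diff_right)

lemma derivative_along_closed_loop_ge:
  "op_H f g q R V x - running_cost q R x (w x) \<le> gradient V x \<bullet> closed_loop f g w x"
  unfolding derivative_along_closed_loop using sym_pos_def_inner_nonneg[OF pos_R] by simp

lemma derivative_along_own_policy:
  "gradient V x \<bullet> closed_loop f g (policy g R V) x = op_H f g q R V x - running_cost q R x (policy g R V x)"
  by (simp add: derivative_along_closed_loop)

section \<open>Continuity of the policy, the closed loop and the cost\<close>

lemma continuous_on_policy:
  assumes "V \<in> C1"
  shows "continuous_on UNIV (policy g R V)"
proof -
  have "continuous_on UNIV (gradient V)" using assms by (simp add: C1_def)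
  then have "continuous_on UNIV (\<lambda>x. matrix_inv (R x) *v (transpose (g x) *v gradient V x))"
    by (intro continuous_on_matrix_inv_mult_vector continuous_on_matrix_vector_mult continuous_on_transpose
        cont_R cont_g sym_pos_def_invertible pos_R)
  then show ?thesis
    unfolding policy_def[abs_def] by (intro continuous_intros)
qed

lemma continuous_on_closed_loop:
  assumes "V \<in> C1"
  shows "continuous_on UNIV (closed_loop f g (policy g R V))"
  unfolding closed_loop_def[abs_def]
  by (intro continuous_intros cont_f continuous_on_matrix_vector_mult cont_g continuous_on_policy assms)

lemma continuous_on_running_cost_policy:
  assumes "V \<in> C1"
  shows "continuous_on UNIV (\<lambda>x. running_cost q R x (policy g R V x))"
  unfolding running_cost_def
  by (intro continuous_intros cont_q continuous_on_matrix_vector_mult cont_R continuous_on_policy assms)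

lemma continuous_on_op_H:
  assumes "V \<in> C1"
  shows "continuous_on UNIV (op_H f g q R V)"
proof -
  have "continuous_on UNIV (gradient V)" using assms by (simp add: C1_def)
  then show ?thesis
    unfolding op_H_policy[abs_def]
    by (intro continuous_intros cont_f cont_q continuous_on_matrix_vector_mult cont_R continuous_on_policy assms)
qed

section \<open>Feasible functions as Lyapunov functions and cost bounds\<close>

lemma feasible_derivative_le:
  assumes "V \<in> RP_feasible f g q R"
  shows "gradient V x \<bullet> closed_loop f g (policy g R V) x \<le> - running_cost q R x (policy g R V x)"
  using assms by (simp add: derivative_along_own_policy RP_feasible_def)

lemma feasible_class_P: "V \<in> RP_feasible f g q R \<Longrightarrow> V \<in> class_P"
  by (simp add: RP_feasible_def)

lemma feasible_GAS:
  assumes V: "V \<in> RP_feasible f g q R"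
  shows "GAS_at_origin (closed_loop f g (policy g R V))"
proof (rule lyapunov_GAS[OF _ _ feasible_class_P[OF V] cont_q pos_q])
  show "continuous_on UNIV (closed_loop f g (policy g R V))"
    by (intro continuous_on_closed_loop class_P_C1 feasible_class_P V)
  show "closed_loop f g (policy g R V) 0 = 0"
    by (simp add: closed_loop_def policy_def f0 class_P_gradient_zero[OF feasible_class_P[OF V]])
  show "gradient V p \<bullet> closed_loop f g (policy g R V) p \<le> - q p" for p
    using feasible_derivative_le[OF V, of p] running_cost_ge[of p] by (smt (verit))
qed

text \<open>Removes the boundary terms at infinity; \<open>W\<close> is independent of
  \<open>V\<close> because two functions are compared along one closed loop.\<close>

lemma feasible_along_trajectory_tendsto_0:
  assumes V: "V \<in> RP_feasible f g q R" and W: "W \<in> class_P"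
    and x: "trajectory (closed_loop f g (policy g R V)) x0 x"
  shows "((\<lambda>t. W (x t)) \<longlongrightarrow> 0) at_top"
proof -
  have "(x \<longlongrightarrow> 0) at_top"
    using feasible_GAS[OF V] x by (auto simp: GAS_at_origin_def)
  moreover have "isCont W 0"
    using C1_continuous_on[OF class_P_C1[OF W], of UNIV] by (simp add: continuous_on_eq_continuous_at)
  ultimately show ?thesis
    using isCont_tendsto_compose[of 0 W x at_top] class_P_zero[OF W] by simp
qed

text \<open>Integrate the decrease of \<open>V\<close> over \<open>{0..T}\<close> and drop the
  nonnegative \<open>V (x T)\<close>; the bound is uniform in \<open>T\<close>.\<close>

lemma feasible_cost_le:
  assumes V: "V \<in> RP_feasible f g q R" and x: "trajectory (closed_loop f g (policy g R V)) x0 x"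
  shows "cost_J q R x (\<lambda>t. policy g R V (x t)) \<le> ereal (V x0)"
proof -
  note VP = feasible_class_P[OF V] and VC = class_P_C1[OF feasible_class_P[OF V]]
  define h where "h t = running_cost q R (x t) (policy g R V (x t))" for t
  have sol: "solution_on (closed_loop f g (policy g R V)) {0..} x" and x0: "x 0 = x0"
    using x by (auto simp: trajectory_def)
  have h: "continuous_on {0..} h"
    unfolding h_def
    by (rule continuous_on_compose2[OF continuous_on_running_cost_policy[OF VC] solution_on_imp_continuous_on[OF sol]]) auto
  have h0: "0 \<le> h t" for t by (simp add: h_def running_cost_nonneg)
  have "(\<integral>\<^sup>+t\<in>{0..}. ennreal (h t) \<partial>lborel) \<le> ennreal (V x0)"
  proof (rule nn_integral_half_line_le[OF h h0])
    fix T :: real assume T: "0 \<le> T"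
    have "((\<lambda>t. gradient V (x t) \<bullet> closed_loop f g (policy g R V) (x t)) has_integral V (x T) - V (x 0)) {0..T}"
      by (intro C1_along_solution_has_integral[OF VC] solution_on_subset[OF sol] T) auto
    moreover have "((\<lambda>t. - h t) has_integral - integral {0..T} h) {0..T}"
      by (intro has_integral_neg integrable_integral integrable_continuous_real continuous_on_subset[OF h]) auto
    ultimately have "V (x T) - V (x 0) \<le> - integral {0..T} h"
      by (rule has_integral_le) (simp add: h_def feasible_derivative_le[OF V])
    then show "integral {0..T} h \<le> V x0"
      using class_P_nonneg[OF VP, of "x T"] x0 by simp
  qed
  then have "enn2ereal (\<integral>\<^sup>+t\<in>{0..}. ennreal (h t) \<partial>lborel) \<le> ereal (V x0)"
    by (metis class_P_nonneg[OF VP] enn2ereal_ennreal less_eq_ennreal.rep_eq)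
  \<comment> \<open>The negative part of the cost integrates to 0, so the extended difference is
    never infinity minus infinity.\<close>
  moreover have "(\<integral>\<^sup>+t\<in>{0..}. ennreal (- h t) \<partial>lborel) = 0"
    using h0 by (simp add: ennreal_neg)
  ultimately show ?thesis
    by (simp add: cost_J_def integral_0_inf_def h_def[symmetric] zero_ennreal.rep_eq)
qed

text \<open>Along the closed loop of \<open>V\<close>, the derivative of \<open>V\<close> is at most
  minus the running cost and that of \<open>W\<close> at least this. So \<open>W - V\<close> is
  nondecreasing and tends to 0, hence starts nonpositive.\<close>

lemma HJB_solution_le_feasible:
  assumes V: "V \<in> RP_feasible f g q R" and W: "W \<in> class_P" "\<And>x. op_H f g q R W x = 0"
  shows "W x0 \<le> V x0"
proof -
  note VP = feasible_class_P[OF V]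
  let ?F = "closed_loop f g (policy g R V)"
  obtain x where x: "trajectory ?F x0 x"
    using feasible_GAS[OF V] unfolding GAS_at_origin_def forward_complete_def by blast
  have sol: "solution_on ?F {0..T} x" for T
    using x by (auto simp: trajectory_def intro: solution_on_subset)
  have "W x0 - V x0 \<le> W (x T) - V (x T)" if "0 \<le> T" for T
  proof -
    have "V (x T) - V (x 0) \<le> W (x T) - W (x 0)"
    proof (rule has_integral_le)
      show "((\<lambda>t. gradient V (x t) \<bullet> ?F (x t)) has_integral V (x T) - V (x 0)) {0..T}"
        "((\<lambda>t. gradient W (x t) \<bullet> ?F (x t)) has_integral W (x T) - W (x 0)) {0..T}"
        by (intro C1_along_solution_has_integral class_P_C1 VP W sol that)+
      show "gradient V (x t) \<bullet> ?F (x t) \<le> gradient W (x t) \<bullet> ?F (x t)" for t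
        using feasible_derivative_le[OF V, of "x t"] derivative_along_closed_loop_ge[of W "x t" "policy g R V"] W(2)
        by simp
    qed
    then show ?thesis using x by (simp add: trajectory_def)
  qed
  moreover have "((\<lambda>T. W (x T) - V (x T)) \<longlongrightarrow> 0 - 0) at_top"
    by (intro tendsto_diff feasible_along_trajectory_tendsto_0[OF V _ x] W(1) VP)
  ultimately have "W x0 - V x0 \<le> 0 - 0"
    by (intro tendsto_lowerbound[of _ _ at_top]) (auto intro: eventually_mono[OF eventually_ge_at_top[of 0]])
  then show ?thesis by simp
qed

text \<open>Under the policy of \<open>W\<close>, the derivative of \<open>W\<close> is exactly
  minus the running cost, so the derivative of \<open>V\<close> exceeds it by at least the value of
  \<open>op_H\<close> at \<open>V\<close>. Integrate and let time tend to infinity.\<close>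

lemma feasible_lower_bound:
  assumes V: "V \<in> RP_feasible f g q R" and W: "W \<in> class_P" "\<And>x. op_H f g q R W x = 0"
    and x: "trajectory (closed_loop f g (policy g R W)) x0 x"
  shows "ereal (V x0) + integral_0_inf (\<lambda>t. op_H f g q R V (x t)) \<le> ereal (W x0)"
proof -
  note VP = feasible_class_P[OF V]
  let ?F = "closed_loop f g (policy g R W)"
  have Wf: "W \<in> RP_feasible f g q R" using W by (simp add: RP_feasible_def)
  define h where "h t = - op_H f g q R V (x t)" for t
  have sol: "solution_on ?F {0..} x" and x0: "x 0 = x0"
    using x by (auto simp: trajectory_def)
  have h: "continuous_on {0..} h"
    unfolding h_def
    by (intro continuous_on_minus continuous_on_compose2[OF continuous_on_op_H solution_on_imp_continuous_on[OF sol]]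
        class_P_C1 VP) auto
  have h0: "0 \<le> h t" for t using V by (simp add: h_def RP_feasible_def)
  define B where "B = (\<integral>\<^sup>+t\<in>{0..}. ennreal (h t) \<partial>lborel)"
  \<comment> \<open>The nonnegative \<open>W (x T)\<close> is dropped; \<open>V (x T)\<close> has
    the unfavourable sign, is kept, and vanishes in the limit.\<close>
  have bound: "V x0 - W x0 - V (x T) \<le> integral {0..T} h" if T: "0 \<le> T" for T
  proof -
    have "- integral {0..T} h + (W (x T) - W (x 0)) \<le> V (x T) - V (x 0)"
    proof (rule has_integral_le)
      show "((\<lambda>t. - h t + gradient W (x t) \<bullet> ?F (x t)) has_integral - integral {0..T} h + (W (x T) - W (x 0))) {0..T}"
        by (intro has_integral_add has_integral_neg integrable_integral integrable_continuous_real
            continuous_on_subset[OF h] C1_along_solution_has_integral class_P_C1 W solution_on_subset[OF sol] T) auto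
      show "((\<lambda>t. gradient V (x t) \<bullet> ?F (x t)) has_integral V (x T) - V (x 0)) {0..T}"
        by (intro C1_along_solution_has_integral class_P_C1 VP solution_on_subset[OF sol] T) auto
      show "- h t + gradient W (x t) \<bullet> ?F (x t) \<le> gradient V (x t) \<bullet> ?F (x t)" for t
        using derivative_along_own_policy[of W "x t"] derivative_along_closed_loop_ge[of V "x t" "policy g R W"] W(2)
        by (simp add: h_def)
    qed
    then show ?thesis using class_P_nonneg[OF W(1), of "x T"] x0 by simp
  qed
  have "(\<integral>\<^sup>+t\<in>{0..}. ennreal (op_H f g q R V (x t)) \<partial>lborel) = 0"
    using h0 by (simp add: ennreal_neg h_def)
  then have int: "integral_0_inf (\<lambda>t. op_H f g q R V (x t)) = - enn2ereal B"
    by (simp add: integral_0_inf_def B_def h_def zero_ennreal.rep_eq)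
  \<comment> \<open>For infinite \<open>B\<close> the left-hand side is minus infinity; for finite
    \<open>B\<close> the bound is taken to the limit in \<open>T\<close>.\<close>
  show ?thesis
  proof (cases B)
    case (real b)
    have "V x0 - W x0 - V (x T) \<le> b" if "0 \<le> T" for T
    proof -
      have "ennreal (integral {0..T} h) \<le> ennreal b"
        using nn_integral_half_line_ge[OF h h0] real by (simp add: B_def)
      then show ?thesis using bound[OF that] real by (simp add: ennreal_le_iff)
    qed
    moreover have "((\<lambda>T. V x0 - W x0 - V (x T)) \<longlongrightarrow> V x0 - W x0 - 0) at_top"
      by (intro tendsto_intros feasible_along_trajectory_tendsto_0[OF Wf VP x])
    ultimately have "V x0 - W x0 - 0 \<le> b"
      by (intro tendsto_upperbound[of _ _ at_top]) (auto intro: eventually_mono[OF eventually_ge_at_top[of 0]])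
    then show ?thesis using real by (simp add: int enn2ereal_ennreal)
  next
    case top
    then show ?thesis by (simp add: int)
  qed
qed

end

section \<open>The five claims about the relaxed problem\<close>

theorem mainTheorem1:
  fixes f :: "real ^ 'n \<Rightarrow> real ^ 'n"
    and g :: "real ^ 'n \<Rightarrow> real ^ 'm ^ 'n"
    and q :: "real ^ 'n \<Rightarrow> real"
    and R :: "real ^ 'n \<Rightarrow> real ^ 'm ^ 'm"
    and V\<^sub>o :: "real ^ 'n \<Rightarrow> real"
    and \<Omega> :: "(real ^ 'n) set"
  assumes "polynomial_function f" and "f 0 = 0"
    and "polynomial_function g"
    and "polynomial_function q" and "pos_def_fun q"
    and "polynomial_function R" and "\<forall>x. sym_pos_def (R x)"
    and A1: "\<exists>V\<^sub>0\<in>class_P. \<exists>u\<^sub>1. \<forall>x. op_L f g q R V\<^sub>0 u\<^sub>1 x \<ge> 0"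
    and A2: "V\<^sub>o \<in> class_P" "\<forall>x. op_H f g q R V\<^sub>o x = 0"
    and "compact \<Omega>" and "0 \<in> interior \<Omega>"
  shows "RP_feasible f g q R \<noteq> {} \<and>
    (\<forall>V\<in>RP_feasible f g q R. globally_stabilizing f g (policy g R V)) \<and>
    (\<forall>V\<in>RP_feasible f g q R. \<forall>x0 x.
       trajectory (closed_loop f g (policy g R V)) x0 x \<longrightarrow>
         cost_J q R x (\<lambda>t. policy g R V (x t)) \<le> ereal (V x0)) \<and>
    (\<forall>V\<in>RP_feasible f g q R. \<forall>x0 x.
       trajectory (closed_loop f g (policy g R V\<^sub>o)) x0 x \<longrightarrow>
         ereal (V x0) + integral_0_inf (\<lambda>t. op_H f g q R V (x t)) \<le> ereal (V\<^sub>o x0) \<and>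
         V\<^sub>o x0 \<le> V x0) \<and>
    RP_optimal f g q R \<Omega> V\<^sub>o"
proof -
  interpret affine_control_problem f g q R
    using assms by unfold_locales (auto intro: continuous_on_polymonial_function)
  \<comment> \<open>Equality in the constraint makes \<open>V\<^sub>o\<close> itself a feasible
    point, which settles the first claim.\<close>
  have Vo: "V\<^sub>o \<in> RP_feasible f g q R" using A2 by (simp add: RP_feasible_def)
  have le: "V\<^sub>o x \<le> V x" if "V \<in> RP_feasible f g q R" for V x
    using HJB_solution_le_feasible[OF that] A2 by blast
  \<comment> \<open>Continuity on the compact set makes both integrals genuine, so the pointwise
    inequality integrates and no default value 0 interferes.\<close>
  have "integral \<Omega> V\<^sub>o \<le> integral \<Omega> V" if "V \<in> RP_feasible f g q R" for V
    using \<open>compact \<Omega>\<close> Vo that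
    by (intro Henstock_Kurzweil_Integration.integral_le integrable_on_compact_continuous
        C1_continuous_on class_P_C1 feasible_class_P le)
  with Vo have "RP_optimal f g q R \<Omega> V\<^sub>o" by (simp add: RP_optimal_def)
  moreover have "ereal (V x0) + integral_0_inf (\<lambda>t. op_H f g q R V (x t)) \<le> ereal (V\<^sub>o x0)"
    if "V \<in> RP_feasible f g q R" "trajectory (closed_loop f g (policy g R V\<^sub>o)) x0 x" for V x0 x
    using feasible_lower_bound that A2 by blast
  ultimately show ?thesis
    using Vo feasible_GAS feasible_cost_le le unfolding globally_stabilizing_def by blast
qed

end
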